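(* For every positive integer $k$, there is an infinite family of (pairwise non-isomorphic) $k$-connected graphs $G$ for which $\chi_T(G)\ne\chi_P(G)$.
   Context: Graphs are finite and simple. A tree-decomposition of a graph $G$ is a pair $(T,\mathcal{B})$ where $T$ is a tree and $\mathcal{B}=\{B_t: t\in V(T)\}$ is a collection of subsets of $V(G)$ (bags) such that $V(G)=\bigcup_{t\in V(T)}B_t$; for each $uv\in E(G)$ there is $t\in V(T)$ with $u,v\in B_t$; and for each $v\in V(G)$ the set of all $t\in V(T)$ with $v\in B_t$ induces a connected subtree of $T$. If $T$ is a path, it is called a path-decomposition. The chromatic number of $(T,\mathcal{B})$ is $\max\{\chi(G[B_t]): t\in V(T)\}$. The tree-chromatic number $\chi_T(G)$ is the minimum chromatic number over all tree-decompositions of $G$; the path-chromatic number $\chi_P(G)$ is the minimum chromatic number over all path-decompositions of $G$. *)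

theory Defs
  imports "Graph_Theory.Graph_Theory"
begin

text \<open>
  Finite simple graphs are rendered by the library locale \<open>pair_graph\<close> (or \<open>graph\<close>):
  finite, loop-free, symmetric digraphs without parallel arcs. An undirected edge
  \<open>uv\<close> is the pair of opposite arcs \<open>(u, v)\<close>, \<open>(v, u)\<close>.
\<close>

definition chromatic_number :: "('a, 'b) pre_digraph \<Rightarrow> nat" where
  "chromatic_number G =
     (LEAST n. \<exists>c :: 'a \<Rightarrow> nat. (\<forall>v\<in>verts G. c v < n) \<and>
        (\<forall>u v. u \<rightarrow>\<^bsub>G\<^esub> v \<longrightarrow> c u \<noteq> c v))"

definition k_connected :: "nat \<Rightarrow> ('a, 'b) pre_digraph \<Rightarrow> bool" where
  "k_connected k G \<longleftrightarrow> k < card (verts G) \<and>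
     (\<forall>X. X \<subseteq> verts G \<and> card X < k \<longrightarrow> connected (G \<restriction> (verts G - X)))"

text \<open>
  The library constant \<open>tree\<close> is not usable for undirected graphs: it forbids all
  directed cycles, and in a symmetric digraph every edge traversed back and forth is
  a directed cycle of length 2. Cycles of a simple graph have length at least 3.
  Note that \<open>connected\<close> includes non-emptiness.
\<close>

definition tree_graph :: "('a, 'b) pre_digraph \<Rightarrow> bool" where
  "tree_graph T \<longleftrightarrow> graph T \<and> connected T \<and>
     \<not> (\<exists>p. pre_digraph.cycle T p \<and> 3 \<le> length p)"

definition path_graph :: "('a, 'b) pre_digraph \<Rightarrow> bool" where
  "path_graph P \<longleftrightarrow> graph P \<and>
     (\<exists>xs. xs \<noteq> [] \<and> distinct xs \<and> verts P = set xs \<and>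
        arcs_ends P = set (vwalk_arcs xs) \<union> (set (vwalk_arcs xs))\<inverse>)"

definition tree_decomposition ::
  "('a, 'b) pre_digraph \<Rightarrow> ('t, 'c) pre_digraph \<Rightarrow> ('t \<Rightarrow> 'a set) \<Rightarrow> bool" where
  "tree_decomposition G T B \<longleftrightarrow> tree_graph T \<and>
     verts G = (\<Union>t\<in>verts T. B t) \<and>
     (\<forall>u v. u \<rightarrow>\<^bsub>G\<^esub> v \<longrightarrow> (\<exists>t\<in>verts T. u \<in> B t \<and> v \<in> B t)) \<and>
     (\<forall>v\<in>verts G. connected (T \<restriction> {t \<in> verts T. v \<in> B t}))"

definition path_decomposition ::
  "('a, 'b) pre_digraph \<Rightarrow> ('t, 'c) pre_digraph \<Rightarrow> ('t \<Rightarrow> 'a set) \<Rightarrow> bool" where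
  "path_decomposition G T B \<longleftrightarrow> tree_decomposition G T B \<and> path_graph T"

definition decomposition_chromatic_number ::
  "('a, 'b) pre_digraph \<Rightarrow> ('t, 'c) pre_digraph \<Rightarrow> ('t \<Rightarrow> 'a set) \<Rightarrow> nat" where
  "decomposition_chromatic_number G T B =
     Max ((\<lambda>t. chromatic_number (G \<restriction> B t)) ` verts T)"

text \<open>
  Trees are finite, so taking their nodes to be natural numbers covers all
  decompositions up to renaming of the nodes. The minima are over non-empty sets, as a
  one-node tree with the single bag \<open>verts G\<close> is a (path-)decomposition.
\<close>

definition tree_chromatic_number :: "('a, 'b) pre_digraph \<Rightarrow> nat" where
  "tree_chromatic_number G =
     (LEAST n. \<exists>(T :: nat pair_pre_digraph) B.
        tree_decomposition G (with_proj T) B \<and>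
        n = decomposition_chromatic_number G (with_proj T) B)"

definition path_chromatic_number :: "('a, 'b) pre_digraph \<Rightarrow> nat" where
  "path_chromatic_number G =
     (LEAST n. \<exists>(T :: nat pair_pre_digraph) B.
        path_decomposition G (with_proj T) B \<and>
        n = decomposition_chromatic_number G (with_proj T) B)"

end

theory Submission
  imports Defs
begin

text \<open>
  Let \<open>W\<close> be completely joined to \<open>a\<close> and \<open>b\<close>. If \<open>a\<close> and \<open>b\<close> share no bag of a
  path-decomposition, then some bag contains all of \<open>W\<close>. A shift graph \<open>W\<close> has large chromatic
  number but a path-decomposition into bipartite bags, so it forces non-adjacent \<open>a\<close>, \<open>b\<close> into
  a common bag of every path-decomposition with 3-colourable bags, while a tree-decomposition can
  handle it on a branch of its own using only 3 colours. Linking all non-adjacent pairs of a set in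
  this way forces, by the Helly property of intervals, the whole set into one bag.

  Take three such sets (legs), each containing three pairwise non-adjacent outer vertices that get
  three distinct colours in every 3-colouring of the leg, and join outer vertices of distinct legs
  completely. A star-shaped tree-decomposition centred at the bag of all outer vertices shows that
  the tree-chromatic number is at most 3. In a path-decomposition, the bag containing the middle one
  of the three legs also contains an outer vertex of another leg, which is adjacent to outer vertices
  of all three colours, so the path-chromatic number exceeds 3.

  Replacing every vertex by \<open>m\<close> independent copies changes neither bound and makes the graph
  \<open>m\<close>-connected; varying \<open>m\<close> gives infinitely many graphs.
\<close>

section \<open>Colourings and connectivity of induced subgraphs\<close>

text \<open>Only upper bounds on chromatic numbers are ever compared. Phrased for a bare relation
  and a set, colourability transfers along maps between vertex types.\<close>

definition colorable_on :: "nat \<Rightarrow> ('a \<Rightarrow> 'a \<Rightarrow> bool) \<Rightarrow> 'a set \<Rightarrow> bool" where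
  "colorable_on n E S \<longleftrightarrow>
     (\<exists>c :: 'a \<Rightarrow> nat. (\<forall>v\<in>S. c v < n) \<and> (\<forall>u\<in>S. \<forall>v\<in>S. E u v \<longrightarrow> c u \<noteq> c v))"

lemma arcs_ends_induce:
  "arcs_ends (with_proj G \<restriction> S) = {(u, v). (u, v) \<in> parcs G \<and> u \<in> S \<and> v \<in> S}"
  by (auto simp: arcs_ends_conv image_iff)

text \<open>An injective numbering of the finite set is a proper colouring since there are no loops,
  so the least number is attained; colourability is monotone in the number of colours.\<close>

lemma chromatic_number_induce_le_iff:
  assumes "finite S" and "\<And>v. (v, v) \<notin> parcs G"
  shows "chromatic_number (with_proj G \<restriction> S) \<le> n \<longleftrightarrow> colorable_on n (\<lambda>u v. (u, v) \<in> parcs G) S"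
proof -
  define P where "P n \<longleftrightarrow> colorable_on n (\<lambda>u v. (u, v) \<in> parcs G) S" for n
  have chrom: "chromatic_number (with_proj G \<restriction> S) = (LEAST n. P n)"
    unfolding chromatic_number_def P_def colorable_on_def arcs_ends_induce
    by (rule arg_cong[where f = Least]) (auto simp: fun_eq_iff)
  obtain f :: "'a \<Rightarrow> nat" and m where f: "f ` S = {i. i < m}" "inj_on f S"
    using finite_imp_inj_to_nat_seg[OF assms(1)] by blast
  have "P m"
    unfolding P_def colorable_on_def
  proof (intro exI conjI ballI impI)
    show "f v < m" if "v \<in> S" for v using f(1) that by blast
    show "f u \<noteq> f v" if "u \<in> S" "v \<in> S" "(u, v) \<in> parcs G" for u v
      using f(2) that assms(2) by (metis inj_onD)
  qed
  then have least: "P (LEAST n. P n)" by (rule LeastI)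
  have mono: "P n" if "P k" "k \<le> n" for k
    using that unfolding P_def colorable_on_def by (blast intro: order_less_le_trans)
  show ?thesis
    unfolding chrom P_def[symmetric] using least mono Least_le[of P n] by blast
qed

text \<open>Symmetrising symmetric arcs adds nothing, so reachability is the closure of the
  restricted arc relation.\<close>

lemma connected_induce_iff:
  assumes "sym (parcs G)"
  shows "connected (with_proj G \<restriction> S) \<longleftrightarrow>
    S \<noteq> {} \<and> (\<forall>u\<in>S. \<forall>v\<in>S. (u, v) \<in> {(x, y). (x, y) \<in> parcs G \<and> x \<in> S \<and> y \<in> S}\<^sup>*)"
    (is "_ \<longleftrightarrow> _ \<and> (\<forall>u\<in>S. \<forall>v\<in>S. _ \<in> ?R\<^sup>*)")
proof -
  let ?M = "mk_symmetric (with_proj G \<restriction> S)"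
  have parcs: "parcs ?M = ?R"
    using assms by (auto simp: parcs_mk_symmetric dest: symD)
  interpret M: pair_wf_digraph ?M
    by unfold_locales (auto simp: parcs)
  have "u \<rightarrow>\<^sup>*\<^bsub>with_proj ?M\<^esub> v \<longleftrightarrow> (u, v) \<in> ?R\<^sup>*" if "u \<in> S" for u v
    using M.reachable_conv'[of u v] that by (simp add: parcs)
  then show ?thesis
    by (auto simp: connected_def strongly_connected_def)
qed

lemma induce_verts: "with_proj G \<restriction> pverts G = with_proj G" if "pair_wf_digraph G"
proof -
  interpret pair_wf_digraph G by fact
  show ?thesis by (auto simp: induce_subgraph_def with_proj_def wellformed')
qed

section \<open>Trees given by a parent function\<close>

definition parent_tree :: "'i set \<Rightarrow> 'i \<Rightarrow> ('i \<Rightarrow> 'i) \<Rightarrow> 'i pair_pre_digraph" where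
  "parent_tree I r par = \<lparr>pverts = I, parcs = (\<Union>i\<in>I - {r}. {(i, par i), (par i, i)})\<rparr>"

text \<open>The strictly decreasing \<open>rank\<close> makes every chain of parents end at
  \<open>r\<close>, and it excludes cycles in the resulting graph.\<close>

locale ranked_parents =
  fixes I :: "'i set" and r :: 'i and par :: "'i \<Rightarrow> 'i" and rank :: "'i \<Rightarrow> nat"
  assumes finite_nodes: "finite I"
    and root: "r \<in> I"
    and parent: "\<And>i. i \<in> I \<Longrightarrow> i \<noteq> r \<Longrightarrow> par i \<in> I \<and> rank (par i) < rank i"
begin

lemma par_in: "i \<in> I \<Longrightarrow> i \<noteq> r \<Longrightarrow> par i \<in> I"
  and rank_par: "i \<in> I \<Longrightarrow> i \<noteq> r \<Longrightarrow> rank (par i) < rank i"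
  using parent by auto

lemma par_neq: "i \<in> I \<Longrightarrow> i \<noteq> r \<Longrightarrow> par i \<noteq> i"
  using rank_par by fastforce

abbreviation "T \<equiv> parent_tree I r par"

lemma pair_graph_parent_tree: "pair_graph T"
proof
  have sub: "parcs T \<subseteq> I \<times> I" using parent by (auto simp: parent_tree_def)
  then show "finite (parcs T)" using finite_nodes finite_subset by blast
  show "symmetric (with_proj T)" by (auto simp: symmetric_def sym_def parent_tree_def)
  show "fst e \<in> pverts T" "snd e \<in> pverts T" if "e \<in> parcs T" for e
    using sub that by (auto simp: parent_tree_def)
  show "fst e \<noteq> snd e" if "e \<in> parcs T" for e
    using that by (auto simp: parent_tree_def dest: par_neq)
qed (use finite_nodes in \<open>simp add: parent_tree_def\<close>)

text \<open>Climbing to parents stays inside \<open>A\<close> until \<open>i0\<close> is met, and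
  the falling rank forces this to happen.\<close>

lemma connected_parent_tree_induce:
  assumes "i0 \<in> A" "A \<subseteq> I" and closed: "\<And>i. i \<in> A \<Longrightarrow> i \<noteq> i0 \<Longrightarrow> i \<noteq> r \<and> par i \<in> A"
  shows "connected (with_proj T \<restriction> A)"
proof -
  let ?R = "{(x, y). (x, y) \<in> parcs T \<and> x \<in> A \<and> y \<in> A}"
  interpret pair_graph T by (rule pair_graph_parent_tree)
  have sym: "sym (parcs T)" using arcs_symmetric by (auto simp: sym_def)
  then have "sym ?R" by (auto simp: sym_def)
  have to_top: "(i, i0) \<in> ?R\<^sup>*" if "i \<in> A" for i
    using that
  proof (induction "rank i" arbitrary: i rule: less_induct)
    case less
    show ?case
    proof (cases "i = i0")
      case False
      then have i: "i \<noteq> r" "par i \<in> A" using closed less.prems by auto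
      then have "(par i, i0) \<in> ?R\<^sup>*" using less parent assms(2) by blast
      moreover have "(i, par i) \<in> ?R"
        using i less.prems assms(2) by (auto simp: parent_tree_def)
      ultimately show ?thesis by (rule converse_rtrancl_into_rtrancl[rotated])
    qed auto
  qed
  have "(u, v) \<in> ?R\<^sup>*" if "u \<in> A" "v \<in> A" for u v
    using to_top[OF that(1)] symD[OF sym_rtrancl[OF \<open>sym ?R\<close>] to_top[OF that(2)]]
    by (rule rtrancl_trans)
  then show ?thesis using connected_induce_iff[OF sym] assms(1) by blast
qed

section \<open>Acyclicity of parent trees\<close>

lemma (in -) tl_pawalk_verts: "pcas u p v \<Longrightarrow> tl (pawalk_verts u p) = map snd p"
proof (induction p arbitrary: u)
  case (Cons e p)
  then have "pawalk_verts (snd e) p = snd e # map snd p" by (cases p) auto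
  then show ?case by simp
qed simp

lemma (in -) pcas_nth:
  assumes "pcas u p v" "i < length p"
  shows "snd (p ! i) = (if Suc i = length p then v else fst (p ! Suc i))"
    and "fst (p ! 0) = u"
proof -
  show "fst (p ! 0) = u" using assms by (cases p) auto
  show "snd (p ! i) = (if Suc i = length p then v else fst (p ! Suc i))"
    using assms
  proof (induction p arbitrary: u i)
    case (Cons e p)
    show ?case
    proof (cases i)
      case 0
      then show ?thesis using Cons.prems by (cases p) auto
    next
      case (Suc i')
      then show ?thesis using Cons.prems Cons.IH[of "snd e" i'] by auto
    qed
  qed simp
qed

text \<open>At a node of maximal rank, both neighbours on a cycle would have to be its parent.\<close>

lemma no_cycle_parent_tree:
  assumes "pre_digraph.cycle (with_proj T) p" shows "length p < 3"
proof (rule ccontr)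
  assume "\<not> length p < 3"
  interpret pair_graph T by (rule pair_graph_parent_tree)
  obtain u where p: "awalk u p u" "distinct (tl (pawalk_verts u p))"
    using assms unfolding cycle_def by auto
  define n where "n = length p"
  have n: "3 \<le> n" using \<open>\<not> length p < 3\<close> by (simp add: n_def)
  have p_parcs: "set p \<subseteq> parcs T" and p_cas: "pcas u p u"
    using p(1) by (auto simp: awalk_def)
  have verts: "tl (pawalk_verts u p) = map snd p"
    using p_cas by (rule tl_pawalk_verts)
  have next_arc: "fst (p ! (Suc i mod n)) = snd (p ! i)" if "i < n" for i
    using pcas_nth(1)[OF p_cas, of i] pcas_nth(2)[OF p_cas, of i] n that by (cases "Suc i = n") (auto simp: n_def)
  define R where "R = (\<lambda>i. rank (snd (p ! i)))"
  have "finite (R ` {..<n})" "R ` {..<n} \<noteq> {}" using n by (auto simp: lessThan_empty_iff)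
  then have "Max (R ` {..<n}) \<in> R ` {..<n}" and max: "\<And>i. i < n \<Longrightarrow> R i \<le> Max (R ` {..<n})"
    by (auto intro: Max_in)
  then obtain k where k: "k < n" "R k = Max (R ` {..<n})" by auto
  \<comment> \<open>The neighbours on the cycle of the top-ranked node \<open>x\<close> are the
    heads of arcs \<open>j\<close> and \<open>l\<close>, the cyclic predecessor and successor of arc
    \<open>k\<close>. They are different arcs because the length is at least 3.\<close>
  define j where "j = (if k = 0 then n - 1 else k - 1)"
  define l where "l = Suc k mod n"
  define x where "x = snd (p ! k)"
  have j: "j < n" "Suc j mod n = k" using k(1) n by (auto simp: j_def)
  have l: "l < n" using n by (auto simp: l_def)
  have "j \<noteq> l" using k(1) n by (cases "Suc k = n") (auto simp: j_def l_def split: if_splits)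
  have to_parent: "y = par x" if "(x, y) \<in> parcs T" "rank y \<le> rank x" for y
    using that parent by (fastforce simp: parent_tree_def)
  have max_x: "rank (snd (p ! i)) \<le> rank x" if "i < n" for i
    using max[OF that] k(2) by (simp add: R_def x_def)
  have "p ! k \<in> parcs T" "p ! l \<in> parcs T"
    using p_parcs k(1) l by (auto simp: n_def)
  moreover have "p ! k = (snd (p ! j), x)" "p ! l = (x, snd (p ! l))"
    using next_arc[OF j(1)] next_arc[OF k(1)] by (auto simp: x_def j(2) l_def[symmetric] prod_eq_iff)
  ultimately have "(x, snd (p ! j)) \<in> parcs T" "(x, snd (p ! l)) \<in> parcs T"
    using arcs_symmetric by metis+
  then have "snd (p ! j) = snd (p ! l)"
    using to_parent max_x j(1) l by metis
  moreover have "distinct (map snd p)" using p(2) verts by simp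
  ultimately show False
    using \<open>j \<noteq> l\<close> j(1) l nth_eq_iff_index_eq[of "map snd p" j l] by (simp add: n_def)
qed

lemma tree_graph_parent_tree: "tree_graph (with_proj T)"
proof -
  interpret pair_graph T by (rule pair_graph_parent_tree)
  have "connected (with_proj T \<restriction> pverts T)"
    by (rule connected_parent_tree_induce[of r]) (use root parent in \<open>auto simp: parent_tree_def\<close>)
  then have "connected (with_proj T)" by (simp add: induce_verts pair_wf_digraph)
  then show ?thesis
    using no_cycle_parent_tree pair_graphD_graph by (fastforce simp: tree_graph_def)
qed

text \<open>Connectedness is replaced by a local test: the nodes whose bags contain \<open>v\<close>
  have a topmost member \<open>i0\<close> and are otherwise closed under taking parents.\<close>

lemma tree_decomposition_parent_tree:
  assumes "pverts G = (\<Union>i\<in>I. B i)"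
    and "\<And>u v. (u, v) \<in> parcs G \<Longrightarrow> \<exists>i\<in>I. u \<in> B i \<and> v \<in> B i"
    and top: "\<And>v. v \<in> pverts G \<Longrightarrow>
      \<exists>i0\<in>I. v \<in> B i0 \<and> (\<forall>i\<in>I. v \<in> B i \<longrightarrow> i \<noteq> i0 \<longrightarrow> i \<noteq> r \<and> v \<in> B (par i))"
  shows "tree_decomposition (with_proj G) (with_proj T) B"
proof -
  have "connected (with_proj T \<restriction> {i \<in> I. v \<in> B i})" if v: "v \<in> pverts G" for v
  proof -
    obtain i0 where "i0 \<in> I" "v \<in> B i0"
      "\<forall>i\<in>I. v \<in> B i \<longrightarrow> i \<noteq> i0 \<longrightarrow> i \<noteq> r \<and> v \<in> B (par i)"
      using top[OF v] by blast
    then show ?thesis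
      by (intro connected_parent_tree_induce[of i0]) (auto intro: par_in)
  qed
  moreover have "pverts T = I" by (simp add: parent_tree_def)
  ultimately show ?thesis
    using assms(1,2) tree_graph_parent_tree unfolding tree_decomposition_def with_proj_simps by simp
qed

end

section \<open>Bounds for the tree- and path-chromatic number\<close>

lemma decomposition_chromatic_number_le_iff:
  assumes "pair_graph G" and dec: "tree_decomposition (with_proj G) (with_proj T) B"
  shows "decomposition_chromatic_number (with_proj G) (with_proj T) B \<le> n \<longleftrightarrow>
    (\<forall>t\<in>pverts T. colorable_on n (\<lambda>u v. (u, v) \<in> parcs G) (B t))"
proof -
  interpret G: pair_graph G by fact
  have "tree_graph (with_proj T)" using dec by (simp add: tree_decomposition_def)
  then have "graph (with_proj T)" "connected (with_proj T)" by (auto simp: tree_graph_def)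
  interpret T: pair_graph T by (rule pair_graphI_graph) fact
  have "pverts T \<noteq> {}"
    using \<open>connected (with_proj T)\<close> by (auto simp: connected_def strongly_connected_def)
  have "B t \<subseteq> pverts G" if "t \<in> pverts T" for t
    using dec that by (auto simp: tree_decomposition_def)
  then have "finite (B t)" if "t \<in> pverts T" for t
    using that G.pair_finite_verts finite_subset by blast
  moreover have "(v, v) \<notin> parcs G" for v using G.no_loops' by blast
  ultimately show ?thesis
    using \<open>pverts T \<noteq> {}\<close> T.pair_finite_verts
    by (simp add: decomposition_chromatic_number_def chromatic_number_induce_le_iff)
qed

text \<open>\<open>tree_chromatic_number\<close> ranges over trees on natural numbers, so the nodes
  are numbered by an injection \<open>f\<close> with inverse \<open>g\<close>, and parents, ranks
  and bags are carried over.\<close>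

lemma (in ranked_parents) tree_chromatic_number_le:
  assumes "pair_graph G" "pverts G = (\<Union>i\<in>I. B i)"
    and edge: "\<And>u v. (u, v) \<in> parcs G \<Longrightarrow> \<exists>i\<in>I. u \<in> B i \<and> v \<in> B i"
    and top: "\<And>v. v \<in> pverts G \<Longrightarrow>
      \<exists>i0\<in>I. v \<in> B i0 \<and> (\<forall>i\<in>I. v \<in> B i \<longrightarrow> i \<noteq> i0 \<longrightarrow> i \<noteq> r \<and> v \<in> B (par i))"
    and "\<And>i. i \<in> I \<Longrightarrow> colorable_on n (\<lambda>u v. (u, v) \<in> parcs G) (B i)"
  shows "tree_chromatic_number (with_proj G) \<le> n"
proof -
  obtain f :: "'i \<Rightarrow> nat" where f: "inj_on f I"
    using finite_imp_inj_to_nat_seg[OF finite_nodes] by blast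
  define g where "g = inv_into I f"
  have g [simp]: "g (f i) = i" if "i \<in> I" for i
    using that f by (simp add: g_def)
  interpret J: ranked_parents "f ` I" "f r" "f \<circ> par \<circ> g" "rank \<circ> g"
  proof
    show "(f \<circ> par \<circ> g) j \<in> f ` I \<and> (rank \<circ> g) ((f \<circ> par \<circ> g) j) < (rank \<circ> g) j"
      if "j \<in> f ` I" "j \<noteq> f r" for j
    proof -
      obtain i where "i \<in> I" "j = f i" "i \<noteq> r" using \<open>j \<in> f ` I\<close> \<open>j \<noteq> f r\<close> by blast
      then show ?thesis using par_in rank_par by simp
    qed
  qed (use finite_nodes root in auto)
  have dec: "tree_decomposition (with_proj G) (with_proj J.T) (B \<circ> g)"
  proof (rule J.tree_decomposition_parent_tree)
    show "pverts G = (\<Union>i\<in>f ` I. (B \<circ> g) i)" using assms(2) by auto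
    show "\<exists>i\<in>f ` I. u \<in> (B \<circ> g) i \<and> v \<in> (B \<circ> g) i" if "(u, v) \<in> parcs G" for u v
      using edge[OF that] by auto
    show "\<exists>i0\<in>f ` I. v \<in> (B \<circ> g) i0 \<and> (\<forall>i\<in>f ` I. v \<in> (B \<circ> g) i \<longrightarrow> i \<noteq> i0 \<longrightarrow>
        i \<noteq> f r \<and> v \<in> (B \<circ> g) ((f \<circ> par \<circ> g) i))" if v: "v \<in> pverts G" for v
    proof -
      obtain i0 where i0: "i0 \<in> I" "v \<in> B i0"
        "\<And>i. i \<in> I \<Longrightarrow> v \<in> B i \<Longrightarrow> i \<noteq> i0 \<Longrightarrow> i \<noteq> r \<and> v \<in> B (par i)"
        using top[OF v] by blast
      show ?thesis
      proof (intro bexI[of _ "f i0"] conjI ballI impI)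
        fix j assume j: "j \<in> f ` I" "v \<in> (B \<circ> g) j" "j \<noteq> f i0"
        then obtain i where i: "i \<in> I" "j = f i" by blast
        then have "v \<in> B i" "i \<noteq> i0" using j by auto
        then have "i \<noteq> r" "v \<in> B (par i)" using i0 i by auto
        then show "j \<noteq> f r" "v \<in> (B \<circ> g) ((f \<circ> par \<circ> g) j)"
          using i root par_in f by (auto simp: inj_on_eq_iff)
      qed (use i0 in auto)
    qed
  qed
  have "decomposition_chromatic_number (with_proj G) (with_proj J.T) (B \<circ> g) \<le> n"
    using assms(5) by (simp add: decomposition_chromatic_number_le_iff[OF assms(1) dec])
      (simp add: parent_tree_def)
  moreover have "tree_chromatic_number (with_proj G) \<le>
      decomposition_chromatic_number (with_proj G) (with_proj J.T) (B \<circ> g)"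
    unfolding tree_chromatic_number_def using dec by (intro Least_le) blast
  ultimately show ?thesis by linarith
qed

text \<open>A path-decomposition seen as a sequence of bags: connectedness becomes convexity, so
  every vertex occupies an interval of indices.\<close>

locale path_bags =
  fixes V :: "'a set" and E :: "'a \<Rightarrow> 'a \<Rightarrow> bool" and D :: "nat \<Rightarrow> 'a set"
  assumes cover: "v \<in> V \<Longrightarrow> \<exists>i. v \<in> D i"
    and edge: "u \<in> V \<Longrightarrow> v \<in> V \<Longrightarrow> E u v \<Longrightarrow> \<exists>i. u \<in> D i \<and> v \<in> D i"
    and convex: "v \<in> V \<Longrightarrow> v \<in> D i \<Longrightarrow> v \<in> D k \<Longrightarrow> i \<le> j \<Longrightarrow> j \<le> k \<Longrightarrow> v \<in> D j"

lemma vwalk_arcs_nth: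
  "(x, y) \<in> set (vwalk_arcs xs) \<Longrightarrow> \<exists>l. Suc l < length xs \<and> x = xs ! l \<and> y = xs ! Suc l"
proof (induction xs rule: vwalk_arcs.induct)
  case (3 x' y' xs)
  then show ?case by (cases "(x, y) = (x', y')") force+
qed auto

text \<open>Bags are numbered along the path; indices beyond its end get the empty bag.\<close>

lemma path_decomposition_path_bags:
  assumes dec: "path_decomposition (with_proj G) (with_proj T) B" and "pair_graph G"
  obtains D where "path_bags (pverts G) (\<lambda>u v. (u, v) \<in> parcs G) D"
    and "\<And>i. D i = {} \<or> (\<exists>t\<in>pverts T. D i = B t)"
proof -
  have tree: "tree_decomposition (with_proj G) (with_proj T) B"
    and path: "path_graph (with_proj T)"
    using dec by (auto simp: path_decomposition_def)
  then obtain xs where xs: "distinct xs" "pverts T = set xs"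
    "parcs T = set (vwalk_arcs xs) \<union> (set (vwalk_arcs xs))\<inverse>"
    by (auto simp: path_graph_def)
  have sym: "sym (parcs T)" unfolding xs(3) by (auto simp: sym_def)
  define D where "D i = (if i < length xs then B (xs ! i) else {})" for i
  have D_iff: "v \<in> D i \<longleftrightarrow> i < length xs \<and> v \<in> B (xs ! i)" for v i
    by (simp add: D_def)
  have "path_bags (pverts G) (\<lambda>u v. (u, v) \<in> parcs G) D"
  proof
    show "\<exists>i. v \<in> D i" if "v \<in> pverts G" for v
      using tree that by (auto simp: tree_decomposition_def xs(2) D_iff in_set_conv_nth)
    show "\<exists>i. u \<in> D i \<and> v \<in> D i" if uv: "(u, v) \<in> parcs G" for u v
    proof -
      obtain t where "t \<in> set xs" "u \<in> B t" "v \<in> B t"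
        using tree uv unfolding tree_decomposition_def with_proj_simps xs(2) by blast
      then show ?thesis by (auto simp: D_iff in_set_conv_nth)
    qed
    show "v \<in> D j" if v: "v \<in> pverts G" "v \<in> D i" "v \<in> D k" "i \<le> j" "j \<le> k" for v i j k
    proof (rule ccontr)
      assume not_j: "v \<notin> D j"
      let ?A = "{t \<in> pverts T. v \<in> B t}"
      have k: "k < length xs" using v(3) by (simp add: D_iff)
      have "connected (with_proj T \<restriction> ?A)"
        using tree v(1) by (simp add: tree_decomposition_def)
      then have "(xs ! i, xs ! k) \<in> {(x, y). (x, y) \<in> parcs T \<and> x \<in> ?A \<and> y \<in> ?A}\<^sup>*"
        using v by (auto simp: connected_induce_iff[OF sym] D_iff xs(2))
      \<comment> \<open>A walk through nodes whose bags contain \<open>v\<close> changes its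
        position by one at each step and never visits position \<open>j\<close>, so it cannot get
        past \<open>j\<close>.\<close>
      then have "\<exists>l<j. xs ! k = xs ! l"
      proof (induction rule: rtrancl_induct)
        case base
        show ?case using v(2,4) not_j by (metis le_neq_implies_less)
      next
        case (step y z)
        then obtain l where l: "l < j" "y = xs ! l" by blast
        have "l < length xs" using l(1) v(5) k by simp
        have z: "z \<noteq> xs ! j" using not_j step(2) v(5) k by (auto simp: D_iff)
        consider l' where "Suc l' < length xs" "y = xs ! l'" "z = xs ! Suc l'"
          | l' where "Suc l' < length xs" "z = xs ! l'" "y = xs ! Suc l'"
          using step(2) vwalk_arcs_nth by (fastforce simp: xs(3))
        then show ?case
        proof cases
          case (1 l')
          then have "l' = l"
            using l xs(1) \<open>l < length xs\<close> by (simp add: nth_eq_iff_index_eq)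
          then have "Suc l < j" using 1 z l(1) by (metis Suc_lessI)
          then show ?thesis using 1 \<open>l' = l\<close> by blast
        next
          case (2 l')
          then have "Suc l' = l"
            using l xs(1) \<open>l < length xs\<close> by (simp add: nth_eq_iff_index_eq)
          then show ?thesis using 2 l(1) by (metis Suc_lessD)
        qed
      qed
      then show False using k v(5) xs(1) by (auto simp: nth_eq_iff_index_eq)
    qed
  qed
  moreover have "D i = {} \<or> (\<exists>t\<in>pverts T. D i = B t)" for i
    by (auto simp: D_def xs(2))
  ultimately show ?thesis using that by blast
qed

text \<open>Guarantees that the minimum in \<open>path_chromatic_number\<close> is attained; a
  single node with all vertices in its bag suffices.\<close>

lemma exists_path_decomposition:
  assumes "pair_graph G"
  shows "\<exists>(T :: nat pair_pre_digraph) B. path_decomposition (with_proj G) (with_proj T) B"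
proof -
  interpret G: pair_graph G by fact
  interpret N: ranked_parents "{0 :: nat}" 0 id id by unfold_locales auto
  have "tree_decomposition (with_proj G) (with_proj N.T) (\<lambda>_. pverts G)"
    by (rule N.tree_decomposition_parent_tree) (auto dest: G.wellformed')
  moreover have "path_graph (with_proj N.T)"
    using N.tree_graph_parent_tree
    by (auto simp: path_graph_def tree_graph_def parent_tree_def intro!: exI[of _ "[0]"])
  ultimately show ?thesis unfolding path_decomposition_def by blast
qed

lemma path_chromatic_number_greater:
  assumes "pair_graph G"
    and no_path: "\<And>D. path_bags (pverts G) (\<lambda>u v. (u, v) \<in> parcs G) D \<Longrightarrow>
      (\<And>i. colorable_on n (\<lambda>u v. (u, v) \<in> parcs G) (D i)) \<Longrightarrow> False"
  shows "n < path_chromatic_number (with_proj G)"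
proof (rule ccontr)
  let ?P = "\<lambda>n. \<exists>(T :: nat pair_pre_digraph) B. path_decomposition (with_proj G) (with_proj T) B \<and>
    n = decomposition_chromatic_number (with_proj G) (with_proj T) B"
  assume "\<not> n < path_chromatic_number (with_proj G)"
  moreover have "?P (path_chromatic_number (with_proj G))"
    unfolding path_chromatic_number_def
    by (rule LeastI_ex[of ?P]) (use exists_path_decomposition[OF assms(1)] in blast)
  ultimately obtain T :: "nat pair_pre_digraph" and B where
    dec: "path_decomposition (with_proj G) (with_proj T) B"
    and le: "decomposition_chromatic_number (with_proj G) (with_proj T) B \<le> n"
    by auto
  obtain D where D: "path_bags (pverts G) (\<lambda>u v. (u, v) \<in> parcs G) D"
    "\<And>i. D i = {} \<or> (\<exists>t\<in>pverts T. D i = B t)"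
    using path_decomposition_path_bags[OF dec assms(1)] by blast
  have "tree_decomposition (with_proj G) (with_proj T) B"
    using dec by (simp add: path_decomposition_def)
  then have "\<forall>t\<in>pverts T. colorable_on n (\<lambda>u v. (u, v) \<in> parcs G) (B t)"
    using le by (simp add: decomposition_chromatic_number_le_iff[OF assms(1)])
  then have "colorable_on n (\<lambda>u v. (u, v) \<in> parcs G) (D i)" for i
    using D(2)[of i] by (auto simp: colorable_on_def)
  then show False using no_path D(1) by blast
qed

section \<open>Blow-ups\<close>

text \<open>This is the blow-up along \<pi>: every vertex is replaced by its fibre, and the fibres
  of adjacent vertices are joined completely.\<close>

definition pullback :: "('b \<Rightarrow> 'a) \<Rightarrow> ('a \<Rightarrow> 'a \<Rightarrow> bool) \<Rightarrow> 'b set \<Rightarrow> 'b pair_pre_digraph" where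
  "pullback \<pi> E X = \<lparr>pverts = X, parcs = {(x, y). x \<in> X \<and> y \<in> X \<and> E (\<pi> x) (\<pi> y)}\<rparr>"

lemma pullback_simps [simp]:
  "pverts (pullback \<pi> E X) = X"
  "(x, y) \<in> parcs (pullback \<pi> E X) \<longleftrightarrow> x \<in> X \<and> y \<in> X \<and> E (\<pi> x) (\<pi> y)"
  by (simp_all add: pullback_def)

locale blow_up =
  fixes V :: "'a set" and E :: "'a \<Rightarrow> 'a \<Rightarrow> bool" and X :: "'b set" and \<pi> :: "'b \<Rightarrow> 'a"
  assumes sym_E: "\<And>u v. u \<in> V \<Longrightarrow> v \<in> V \<Longrightarrow> E u v \<Longrightarrow> E v u"
    and irrefl_E: "\<And>v. v \<in> V \<Longrightarrow> \<not> E v v"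
    and finite_X: "finite X"
    and image_\<pi>: "\<pi> ` X = V"
begin

abbreviation "G \<equiv> pullback \<pi> E X"

lemma pair_graph_pullback: "pair_graph G"
proof
  show "finite (parcs G)"
    by (rule finite_subset[of _ "X \<times> X"]) (use finite_X in auto)
  show "symmetric (with_proj G)"
    using sym_E image_\<pi> by (auto simp: symmetric_def sym_def)
  show "fst e \<noteq> snd e" if "e \<in> parcs G" for e
    using that irrefl_E image_\<pi> by (cases e) auto
  show "fst e \<in> pverts G" "snd e \<in> pverts G" if "e \<in> parcs G" for e
    using that by (cases e; simp)+
qed (simp add: finite_X)

text \<open>Deleting fewer than \<open>k\<close> vertices leaves a copy of every base vertex, so
  walks of the base lift to surviving copies. Walks of positive length are required even for
  \<open>u = v\<close>, since two copies of one vertex must also be joined.\<close>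

lemma k_connected_pullback:
  assumes "k < card X" and fibre: "\<And>v. v \<in> V \<Longrightarrow> k \<le> card {x \<in> X. \<pi> x = v}"
    and conn: "\<And>u v. u \<in> V \<Longrightarrow> v \<in> V \<Longrightarrow> (\<lambda>u v. u \<in> V \<and> v \<in> V \<and> E u v)\<^sup>+\<^sup>+ u v"
  shows "k_connected k (with_proj G)"
proof -
  interpret pair_graph G by (rule pair_graph_pullback)
  have sym: "sym (parcs G)" using arcs_symmetric by (auto simp: sym_def)
  have "connected (with_proj G \<restriction> (X - Y))" if Y: "Y \<subseteq> X" "card Y < k" for Y
  proof -
    let ?S = "X - Y"
    let ?R = "{(x, y). (x, y) \<in> parcs G \<and> x \<in> ?S \<and> y \<in> ?S}"
    have "finite Y" using Y(1) finite_X finite_subset by blast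
    have survivor: "\<exists>x\<in>?S. \<pi> x = v" if "v \<in> V" for v
    proof (rule ccontr)
      assume "\<not> ?thesis"
      then have "{x \<in> X. \<pi> x = v} \<subseteq> Y" by auto
      then have "card {x \<in> X. \<pi> x = v} \<le> card Y" by (intro card_mono \<open>finite Y\<close>)
      then show False using fibre[OF that] Y(2) by linarith
    qed
    have walk: "(x, y) \<in> ?R\<^sup>*"
      if "(\<lambda>u v. u \<in> V \<and> v \<in> V \<and> E u v)\<^sup>+\<^sup>+ u v" "x \<in> ?S" "\<pi> x = u" "y \<in> ?S" "\<pi> y = v" for u v x y
      using that
    proof (induction arbitrary: y rule: tranclp_induct)
      case (base v)
      then show ?case by (intro r_into_rtrancl) simp
    next
      case (step v w)
      then obtain z where z: "z \<in> ?S" "\<pi> z = v" using survivor by blast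
      have "(x, z) \<in> ?R\<^sup>*" using step.IH step.prems z by blast
      moreover have "(z, y) \<in> ?R" using step.hyps step.prems z by auto
      ultimately show ?case by (rule rtrancl_into_rtrancl)
    qed
    have "(x, y) \<in> ?R\<^sup>*" if "x \<in> ?S" "y \<in> ?S" for x y
    proof -
      have "\<pi> x \<in> V" "\<pi> y \<in> V" using that image_\<pi> by blast+
      then show ?thesis using walk[OF conn] that by blast
    qed
    moreover have "X \<noteq> Y" using Y(2) assms(1) by auto
    then have "?S \<noteq> {}" using Y(1) by blast
    ultimately show ?thesis using connected_induce_iff[OF sym] by blast
  qed
  then show ?thesis using assms(1) by (simp add: k_connected_def)
qed

text \<open>Preimages of bags form a tree-decomposition of the blow-up, and colourings compose with
  \<pi>.\<close>

lemma tree_chromatic_number_pullback_le: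
  assumes "ranked_parents I r par rank" and "V = (\<Union>i\<in>I. B i)"
    and edge: "\<And>u v. u \<in> V \<Longrightarrow> v \<in> V \<Longrightarrow> E u v \<Longrightarrow> \<exists>i\<in>I. u \<in> B i \<and> v \<in> B i"
    and top: "\<And>v. v \<in> V \<Longrightarrow>
      \<exists>i0\<in>I. v \<in> B i0 \<and> (\<forall>i\<in>I. v \<in> B i \<longrightarrow> i \<noteq> i0 \<longrightarrow> i \<noteq> r \<and> v \<in> B (par i))"
    and col: "\<And>i. i \<in> I \<Longrightarrow> colorable_on n E (B i)"
  shows "tree_chromatic_number (with_proj G) \<le> n"
proof -
  interpret ranked_parents I r par rank by fact
  have \<pi>: "\<pi> x \<in> V" if "x \<in> X" for x using that image_\<pi> by blast
  define C where "C i = {x \<in> X. \<pi> x \<in> B i}" for i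
  show ?thesis
  proof (rule tree_chromatic_number_le[where B = C, OF pair_graph_pullback])
    show "pverts G = (\<Union>i\<in>I. C i)" using \<pi> assms(2) by (auto simp: C_def)
    show "\<exists>i\<in>I. u \<in> C i \<and> v \<in> C i" if "(u, v) \<in> parcs G" for u v
      using that edge[of "\<pi> u" "\<pi> v"] \<pi> by (auto simp: C_def)
    show "\<exists>i0\<in>I. v \<in> C i0 \<and> (\<forall>i\<in>I. v \<in> C i \<longrightarrow> i \<noteq> i0 \<longrightarrow> i \<noteq> r \<and> v \<in> C (par i))"
      if "v \<in> pverts G" for v
      using that top[of "\<pi> v"] \<pi> by (simp add: C_def)
    show "colorable_on n (\<lambda>u v. (u, v) \<in> parcs G) (C i)" if i: "i \<in> I" for i
    proof -
      obtain c :: "'a \<Rightarrow> nat" where "\<forall>v\<in>B i. c v < n" "\<forall>u\<in>B i. \<forall>v\<in>B i. E u v \<longrightarrow> c u \<noteq> c v"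
        using col[OF i] by (auto simp: colorable_on_def)
      then show ?thesis
        unfolding colorable_on_def by (intro exI[of _ "c \<circ> \<pi>"]) (auto simp: C_def)
    qed
  qed
qed

text \<open>Choosing one copy \<open>h v\<close> of each vertex embeds the base graph in the
  blow-up, so bags and their colourings restrict to it.\<close>

lemma path_chromatic_number_pullback_greater:
  assumes no_path: "\<And>D. path_bags V E D \<Longrightarrow> (\<And>i. colorable_on n E (D i)) \<Longrightarrow> False"
  shows "n < path_chromatic_number (with_proj G)"
proof (rule path_chromatic_number_greater[OF pair_graph_pullback])
  fix D assume "path_bags (pverts G) (\<lambda>u v. (u, v) \<in> parcs G) D"
    and col: "\<And>i. colorable_on n (\<lambda>u v. (u, v) \<in> parcs G) (D i)"
  then interpret D: path_bags X "\<lambda>u v. (u, v) \<in> parcs G" D by simp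
  define h where "h = inv_into X \<pi>"
  have h: "h v \<in> X" "\<pi> (h v) = v" if "v \<in> V" for v
    using that image_\<pi> by (auto simp: h_def inv_into_into f_inv_into_f)
  define D' where "D' i = {v \<in> V. h v \<in> D i}" for i
  have "path_bags V E D'"
  proof
    show "\<exists>i. v \<in> D' i" if "v \<in> V" for v
      using that D.cover[of "h v"] h by (auto simp: D'_def)
    show "\<exists>i. u \<in> D' i \<and> v \<in> D' i" if "u \<in> V" "v \<in> V" "E u v" for u v
      using that D.edge[of "h u" "h v"] h by (auto simp: D'_def)
    show "v \<in> D' j" if "v \<in> V" "v \<in> D' i" "v \<in> D' k" "i \<le> j" "j \<le> k" for v i j k
      using that D.convex[of "h v" i k j] h by (auto simp: D'_def)
  qed
  moreover have "colorable_on n E (D' i)" for i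
  proof -
    obtain c :: "'b \<Rightarrow> nat" where "\<forall>v\<in>D i. c v < n"
      "\<forall>u\<in>D i. \<forall>v\<in>D i. (u, v) \<in> parcs G \<longrightarrow> c u \<noteq> c v"
      using col[of i] by (auto simp: colorable_on_def)
    then show ?thesis
      unfolding colorable_on_def using h by (intro exI[of _ "c \<circ> h"]) (auto simp: D'_def)
  qed
  ultimately show False using no_path by blast
qed

end

section \<open>Path-decompositions and shift graphs\<close>

context path_bags
begin

text \<open>All bags with \<open>u\<close> precede the first bag with \<open>y\<close>, so by convexity that bag contains every
  common neighbour.\<close>

lemma separated_common_neighbours_aux:
  assumes "u \<in> V" "y \<in> V" and disj: "\<And>i. \<not> (u \<in> D i \<and> y \<in> D i)"
    and "W \<subseteq> V" "\<And>w. w \<in> W \<Longrightarrow> E w u \<and> E w y"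
    and "u \<in> D a" "y \<in> D b" "a \<le> b"
  shows "\<exists>i. W \<subseteq> D i"
proof -
  define m where "m = (LEAST i. y \<in> D i \<and> a \<le> i)"
  have m: "y \<in> D m" "a \<le> m"
    unfolding m_def using LeastI[of "\<lambda>i. y \<in> D i \<and> a \<le> i" b] assms(7,8) by auto
  have u_before: "i < m" if "u \<in> D i" for i
    using convex[of u a i m] assms(1,6) that m disj by (meson not_le)
  have y_after: "m \<le> i" if "y \<in> D i" for i
  proof (cases "a \<le> i")
    case True
    then show ?thesis unfolding m_def using that by (intro Least_le) simp
  next
    case False
    then show ?thesis using convex[of y i m a] assms(2,6) that m disj by (meson nat_le_linear)
  qed
  have "w \<in> D m" if w: "w \<in> W" for w
  proof -
    have "w \<in> V" "E w u" "E w y" using w assms(4,5) by auto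
    obtain i where "w \<in> D i" "u \<in> D i" using edge[OF \<open>w \<in> V\<close> assms(1) \<open>E w u\<close>] by blast
    moreover obtain j where "w \<in> D j" "y \<in> D j" using edge[OF \<open>w \<in> V\<close> assms(2) \<open>E w y\<close>] by blast
    ultimately show ?thesis
      using convex[OF \<open>w \<in> V\<close>, of i j m] u_before[of i] y_after[of j] by simp
  qed
  then show ?thesis by blast
qed

lemma separated_common_neighbours:
  assumes "u \<in> V" "y \<in> V" "\<And>i. \<not> (u \<in> D i \<and> y \<in> D i)"
    and "W \<subseteq> V" "\<And>w. w \<in> W \<Longrightarrow> E w u \<and> E w y"
  shows "\<exists>i. W \<subseteq> D i"
proof -
  obtain a b where "u \<in> D a" "y \<in> D b" using cover assms(1,2) by blast
  moreover have "a \<le> b \<or> b \<le> a" by linarith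
  moreover have "\<And>i. \<not> (y \<in> D i \<and> u \<in> D i)" "\<And>w. w \<in> W \<Longrightarrow> E w y \<and> E w u"
    using assms(3,5) by blast+
  ultimately show ?thesis
    using separated_common_neighbours_aux[of u y W a b, OF assms]
      separated_common_neighbours_aux[of y u W b a, OF assms(2,1)] assms(4) by blast
qed

text \<open>The bag at the largest left endpoint works: every other interval starts no later, and it
  reaches that far because it meets the interval of \<open>v0\<close>.\<close>

lemma Helly:
  assumes "finite Q" "Q \<subseteq> V" "\<And>u v. u \<in> Q \<Longrightarrow> v \<in> Q \<Longrightarrow> \<exists>i. u \<in> D i \<and> v \<in> D i"
  shows "\<exists>i. Q \<subseteq> D i"
proof (cases "Q = {}")
  case False
  define l where "l v = (LEAST i. v \<in> D i)" for v
  have l_in: "v \<in> D (l v)" if "v \<in> Q" for v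
    using cover[of v] that assms(2) unfolding l_def by (metis LeastI subsetD)
  have l_le: "l v \<le> i" if "v \<in> D i" for v i
    using that unfolding l_def by (rule Least_le)
  have "Max (l ` Q) \<in> l ` Q" using assms(1) False by (intro Max_in) auto
  then obtain v0 where v0: "v0 \<in> Q" "l v0 = Max (l ` Q)" by auto
  have "v \<in> D (l v0)" if v: "v \<in> Q" for v
  proof -
    obtain i where "v \<in> D i" "v0 \<in> D i" using assms(3) v v0 by blast
    moreover have "l v \<le> l v0" using v0(2) v assms(1) by simp
    ultimately show ?thesis
      using convex[of v "l v" i "l v0"] l_in[OF v] l_le[of v0 i] v assms(2) by blast
  qed
  then show ?thesis by blast
qed simp

end

text \<open>The colour sets \<open>{c p q |q. p < q}\<close> are pairwise distinct, as \<open>c p q\<close> belongs to that of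
  \<open>p\<close> but not to that of \<open>q\<close>.\<close>

lemma shift_graph_colouring:
  fixes c :: "nat \<Rightarrow> nat \<Rightarrow> nat"
  assumes range: "\<And>p q. p < q \<Longrightarrow> q < N \<Longrightarrow> c p q < n"
    and proper: "\<And>p q r. p < q \<Longrightarrow> q < r \<Longrightarrow> r < N \<Longrightarrow> c p q \<noteq> c q r"
  shows "N \<le> 2 ^ n"
proof -
  define F where "F p = {c p q |q. p < q \<and> q < N}" for p
  have neq: "F p \<noteq> F q" if "p < q" "q < N" for p q
  proof -
    have "c p q \<in> F p" "c p q \<notin> F q" using that proper by (auto simp: F_def)
    then show ?thesis by blast
  qed
  have "inj_on F {..<N}"
    by (rule inj_onI) (metis lessThan_iff neq nat_neq_iff)
  moreover have "F ` {..<N} \<subseteq> Pow {..<n}" using range by (auto simp: F_def)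
  ultimately have "card {..<N} \<le> card (Pow {..<n})" by (intro card_inj_on_le) auto
  then show ?thesis by (simp add: card_Pow)
qed

section \<open>The base graph\<close>

text \<open>A core vertex \<open>(i, s, j)\<close> lies in leg \<open>i\<close>. Leg \<open>i\<close> consists of the triangle of the vertices
  \<open>(i, False, j)\<close> and of the outer vertices \<open>(i, True, j)\<close>, the latter adjacent to all of the triangle
  but \<open>(i, False, j)\<close>; so every 3-colouring of a leg uses all three colours on the outer vertices.\<close>

type_synonym core = "nat \<times> bool \<times> nat"

definition Core_verts :: "core set" where
  "Core_verts = {..<3} \<times> UNIV \<times> {..<3}"

fun core_adj :: "core \<Rightarrow> core \<Rightarrow> bool" where
  "core_adj (i, s, j) (i', s', j') = (if i = i' then j \<noteq> j' \<and> \<not> (s \<and> s') else s \<and> s')"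

text \<open>Both orders of a pair and the diagonal \<open>a = b\<close> are included, so any two
  core vertices of one leg are either adjacent or linked.\<close>

definition linked :: "core \<Rightarrow> core \<Rightarrow> bool" where
  "linked a b \<longleftrightarrow> a \<in> Core_verts \<and> b \<in> Core_verts \<and> fst a = fst b \<and> \<not> core_adj a b"

text \<open>\<open>Link a b p q\<close> is the vertex \<open>(p, q)\<close> of a shift graph joined completely to \<open>a\<close> and \<open>b\<close>.\<close>

datatype vertex = Core core | Link core core nat nat

text \<open>The last clause is shift graph adjacency: one pair ends where the other begins.\<close>

fun adj :: "vertex \<Rightarrow> vertex \<Rightarrow> bool" where
  "adj (Core a) (Core b) = core_adj a b"
| "adj (Core c) (Link a b p q) = (c = a \<or> c = b)"
| "adj (Link a b p q) (Core c) = (c = a \<or> c = b)"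
| "adj (Link a b p q) (Link a' b' p' q') = (a = a' \<and> b = b' \<and> (q = p' \<or> q' = p))"

text \<open>Nine is the least number of points exceeding \<open>2 ^ 3\<close>, cf. \<open>shift_graph_colouring\<close>.\<close>

definition Verts :: "vertex set" where
  "Verts = Core ` Core_verts \<union> {Link a b p q |a b p q. linked a b \<and> p < q \<and> q < 9}"

lemma core_adj_sym: "core_adj a b \<Longrightarrow> core_adj b a"
  by (cases a; cases b) (auto split: if_splits)

lemma core_adj_irrefl: "\<not> core_adj a a"
  by (cases a) simp

lemma adj_sym: "adj u v \<Longrightarrow> adj v u"
  by (cases u; cases v) (auto intro: core_adj_sym)

lemma adj_irrefl: "v \<in> Verts \<Longrightarrow> \<not> adj v v"
  by (auto simp: Verts_def)

lemma in_Verts [simp]: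
  "Core a \<in> Verts \<longleftrightarrow> a \<in> Core_verts"
  "Link a b p q \<in> Verts \<longleftrightarrow> linked a b \<and> p < q \<and> q < 9"
  unfolding Verts_def by (blast, blast)

lemma finite_Core_verts: "finite Core_verts"
  by (simp add: Core_verts_def)

lemma finite_Verts: "finite Verts"
proof -
  have "Verts \<subseteq> Core ` Core_verts \<union>
      (\<Union>a\<in>Core_verts. \<Union>b\<in>Core_verts. \<Union>p<9. \<Union>q<9. {Link a b p q})"
  proof
    fix v assume "v \<in> Verts"
    then show "v \<in> Core ` Core_verts \<union> (\<Union>a\<in>Core_verts. \<Union>b\<in>Core_verts. \<Union>p<9. \<Union>q<9. {Link a b p q})"
    proof (cases v)
      case (Link a b p q)
      then have "a \<in> Core_verts" "b \<in> Core_verts" "p < 9" "q < 9"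
        using \<open>v \<in> Verts\<close> by (simp_all add: linked_def)
      with Link show ?thesis by blast
    qed simp
  qed
  then show ?thesis
    by (rule finite_subset) (intro finite_UnI finite_UN_I finite_imageI finite_Core_verts; simp)
qed

lemma in_Core_verts [simp]: "(i, s, j) \<in> Core_verts \<longleftrightarrow> i < 3 \<and> j < 3"
  by (simp add: Core_verts_def)

text \<open>All vertices walk to the outer vertex \<open>h\<close>: links step to a core vertex,
  triangle vertices to an outer vertex of their leg, and outer vertices reach \<open>h\<close>
  directly or, from leg 0, through leg 1.\<close>

lemma adj_connected:
  assumes "u \<in> Verts" "v \<in> Verts"
  shows "(\<lambda>u v. u \<in> Verts \<and> v \<in> Verts \<and> adj u v)\<^sup>+\<^sup>+ u v" 
proof -
  define R where "R = (\<lambda>u v. u \<in> Verts \<and> v \<in> Verts \<and> adj u v)"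
  have R: "R u v \<longleftrightarrow> u \<in> Verts \<and> v \<in> Verts \<and> adj u v" for u v by (simp add: R_def)
  define h where "h = Core (0, True, 0)"
  have outer: "R\<^sup>*\<^sup>* (Core (i, True, j)) h" if "i < 3" "j < 3" for i j
  proof (cases "i = 0")
    case True
    then have "R (Core (i, True, j)) (Core (1, True, 0))" "R (Core (1, True, 0)) h"
      using that by (auto simp: h_def R)
    then show ?thesis by (metis converse_rtranclp_into_rtranclp r_into_rtranclp)
  next
    case False
    then have "R (Core (i, True, j)) h" using that by (simp add: h_def R)
    then show ?thesis by (rule r_into_rtranclp)
  qed
  have core: "R\<^sup>*\<^sup>* (Core a) h" if "a \<in> Core_verts" for a
  proof -
    obtain i s j where a: "a = (i, s, j)" by (cases a)
    then have ij: "i < 3" "j < 3" using that by auto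
    show ?thesis
    proof (cases s)
      case False
      define j' :: nat where "j' = (if j = 0 then 1 else 0)"
      have "R (Core a) (Core (i, True, j'))" "j' < 3" using a ij False by (auto simp: j'_def R)
      then show ?thesis using outer[OF ij(1)] by (metis converse_rtranclp_into_rtranclp)
    qed (use a ij outer in simp)
  qed
  have to_h: "R\<^sup>*\<^sup>* w h" if "w \<in> Verts" for w
  proof (cases w)
    case (Link a b p q)
    then have "R w (Core a)" "a \<in> Core_verts" using that by (auto simp: linked_def R)
    then show ?thesis using core by (metis converse_rtranclp_into_rtranclp)
  qed (use that core in simp)
  have "symp R" by (auto simp: symp_def R intro: adj_sym)
  then have "R\<^sup>*\<^sup>* h v" using to_h[OF assms(2)] by (metis symp_rtranclp sympD)
  \<comment> \<open>A detour from \<open>h\<close> and back makes the walk have positive length even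
    when both ends equal \<open>h\<close>.\<close>
  moreover have "R\<^sup>+\<^sup>+ h h"
  proof -
    have "R h (Core (1, True, 0))" "R (Core (1, True, 0)) h" by (simp_all add: h_def R)
    then show ?thesis by (rule tranclp.intros(2)[OF tranclp.intros(1)])
  qed
  ultimately show ?thesis
    using to_h[OF assms(1)] unfolding R_def[symmetric] by (metis rtranclp_tranclp_tranclp tranclp_rtranclp_tranclp)
qed

subsection \<open>The path-chromatic number exceeds 3\<close>

text \<open>Otherwise one bag would contain the whole shift graph on nine points, whose 3-colouring
  would give \<open>9 \<le> 2 ^ 3\<close>.\<close>

lemma linked_common_bag:
  assumes "path_bags Verts adj D" and col: "\<And>i. colorable_on 3 adj (D i)" and "linked a b"
  shows "\<exists>i. Core a \<in> D i \<and> Core b \<in> D i"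
proof (rule ccontr)
  interpret path_bags Verts adj D by fact
  assume disj: "\<not> ?thesis"
  have "\<exists>i. {Link a b p q |p q. p < q \<and> q < 9} \<subseteq> D i"
  proof (rule separated_common_neighbours)
    show "Core a \<in> Verts" "Core b \<in> Verts" using assms(3) by (simp_all add: linked_def)
  qed (use disj assms(3) in auto)
  then obtain i where i: "{Link a b p q |p q. p < q \<and> q < 9} \<subseteq> D i" by blast
  obtain c :: "vertex \<Rightarrow> nat" where c: "\<And>v. v \<in> D i \<Longrightarrow> c v < 3"
      "\<And>u v. u \<in> D i \<Longrightarrow> v \<in> D i \<Longrightarrow> adj u v \<Longrightarrow> c u \<noteq> c v"
    using col[of i] unfolding colorable_on_def by blast
  have "(9 :: nat) \<le> 2 ^ 3"
  proof (rule shift_graph_colouring[of 9 "\<lambda>p q. c (Link a b p q)"])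
    show "c (Link a b p q) < 3" if "p < q" "q < 9" for p q
      using i that by (intro c) blast
    show "c (Link a b p q) \<noteq> c (Link a b q r)" if "p < q" "q < r" "r < 9" for p q r
    proof (rule c(2))
      show "Link a b p q \<in> D i" "Link a b q r \<in> D i"
        using i that order_less_trans by blast+
    qed simp
  qed
  then show False by simp
qed

lemma middle_of_three:
  fixes t :: "nat \<Rightarrow> nat"
  obtains a b c where "{a, b, c} = {..<3 :: nat}" "a \<noteq> b" "b \<noteq> c" "a \<noteq> c" "t a \<le> t b" "t b \<le> t c"
proof -
  have three: "{..<3 :: nat} = {0, 1, 2}" by auto
  consider "t 0 \<le> t 1" "t 1 \<le> t 2" | "t 0 \<le> t 2" "t 2 \<le> t 1" | "t 1 \<le> t 0" "t 0 \<le> t 2"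
    | "t 1 \<le> t 2" "t 2 \<le> t 0" | "t 2 \<le> t 0" "t 0 \<le> t 1" | "t 2 \<le> t 1" "t 1 \<le> t 0"
    by linarith
  then show ?thesis
    using that[of 0 1 2] that[of 0 2 1] that[of 1 0 2] that[of 1 2 0] that[of 2 0 1] that[of 2 1 0]
    unfolding three by cases auto
qed

lemma third_colour:
  fixes a b c x :: nat
  assumes "a < 3" "b < 3" "c < 3" "x < 3" "a \<noteq> b" "a \<noteq> c" "b \<noteq> c" "x \<noteq> b" "x \<noteq> c"
  shows "x = a"
  using assms by linarith

lemma no_path_bags:
  assumes "path_bags Verts adj D" and col: "\<And>i. colorable_on 3 adj (D i)"
  shows False
proof -
  interpret path_bags Verts adj D by fact
  define Leg where "Leg i = {Core (i, s, j) |s j. j < 3}" for i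
  \<comment> \<open>Two vertices of a leg share a bag by adjacency or by their link, so Helly puts
    the whole leg into one bag.\<close>
  have "\<exists>t. Leg i \<subseteq> D t" if "i < 3" for i
  proof (rule Helly)
    have "Leg i = (\<lambda>(s, j). Core (i, s, j)) ` (UNIV \<times> {..<3})" by (auto simp: Leg_def)
    then show "finite (Leg i)" by simp
    show "Leg i \<subseteq> Verts" using that by (auto simp: Leg_def)
    show "\<exists>t. u \<in> D t \<and> v \<in> D t" if uv: "u \<in> Leg i" "v \<in> Leg i" for u v
    proof -
      obtain a b where ab: "u = Core a" "v = Core b" "a \<in> Core_verts" "b \<in> Core_verts" "fst a = fst b"
        using uv \<open>i < 3\<close> by (auto simp: Leg_def)
      show ?thesis
      proof (cases "core_adj a b")
        case True
        then show ?thesis using edge[of u v] ab by simp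
      next
        case False
        then show ?thesis using linked_common_bag[OF assms] ab by (simp add: linked_def)
      qed
    qed
  qed
  then obtain t where t: "\<And>i. i < 3 \<Longrightarrow> Leg i \<subseteq> D (t i)" by metis
  obtain a b c where abc: "{a, b, c} = {..<3 :: nat}" "a \<noteq> b" "b \<noteq> c" "a \<noteq> c" "t a \<le> t b" "t b \<le> t c"
    using middle_of_three by metis
  then have less: "a < 3" "b < 3" "c < 3" by blast+
  have in_bag: "Core (i, r, j) \<in> D (t i)" if "i < 3" "j < 3" for i r j
  proof -
    have "Core (i, r, j) \<in> Leg i" using that by (auto simp: Leg_def)
    then show ?thesis using t[OF that(1)] by blast
  qed
  \<comment> \<open>The outer vertices of the two extreme legs are adjacent and meet in some bag
    \<open>s\<close>. On whichever side of \<open>t b\<close> it lies, convexity carries one of them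
    into the bag of the middle leg.\<close>
  obtain s where s: "Core (a, True, 0) \<in> D s" "Core (c, True, 0) \<in> D s"
    using edge[of "Core (a, True, 0)" "Core (c, True, 0)"] less abc(4) by auto
  have "Core (a, True, 0) \<in> D (t a)" "Core (c, True, 0) \<in> D (t c)"
    using in_bag less by simp_all
  then have "Core (a, True, 0) \<in> D (t b) \<or> Core (c, True, 0) \<in> D (t b)"
    using convex[of "Core (a, True, 0)" "t a" s "t b"] convex[of "Core (c, True, 0)" s "t c" "t b"] s less abc(5,6)
    by (cases "t b \<le> s") simp_all
  then obtain e where e: "e \<noteq> b" "Core (e, True, 0) \<in> D (t b)" using abc(2,3) by metis
  obtain k :: "vertex \<Rightarrow> nat" where k: "\<And>v. v \<in> D (t b) \<Longrightarrow> k v < 3"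
      "\<And>u v. u \<in> D (t b) \<Longrightarrow> v \<in> D (t b) \<Longrightarrow> adj u v \<Longrightarrow> k u \<noteq> k v"
    using col[of "t b"] unfolding colorable_on_def by blast
  define w where "w j = k (Core (b, False, j))" for j
  define u where "u j = k (Core (b, True, j))" for j
  have "w j < 3" "u j < 3" if "j < 3" for j
    using k(1) in_bag less(2) that by (auto simp: w_def u_def)
  moreover have "w i \<noteq> w j" "u i \<noteq> w j" if "i < 3" "j < 3" "i \<noteq> j" for i j
    unfolding w_def u_def
    using k(2)[of "Core (b, False, i)" "Core (b, False, j)"] k(2)[of "Core (b, True, i)" "Core (b, False, j)"]
      in_bag less(2) that by simp_all
  moreover have "k (Core (e, True, 0)) \<noteq> u j" if "j < 3" for j
    unfolding u_def using k(2)[of "Core (e, True, 0)" "Core (b, True, j)"] in_bag less(2) that e by simp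
  moreover have "k (Core (e, True, 0)) < 3" using k(1) e(2) .
  moreover have "(0 :: nat) < 3" "(1 :: nat) < 3" "(2 :: nat) < 3" by auto
  ultimately have "{w 0, w 1, w 2, u 0, u 1, u 2, k (Core (e, True, 0))} \<subseteq> {..<3}"
    and neq: "w 0 \<noteq> w 1" "w 0 \<noteq> w 2" "w 1 \<noteq> w 2" "u 0 \<noteq> w 1" "u 0 \<noteq> w 2" "u 1 \<noteq> w 0" "u 1 \<noteq> w 2"
      "u 2 \<noteq> w 0" "u 2 \<noteq> w 1" "k (Core (e, True, 0)) \<noteq> u 0" "k (Core (e, True, 0)) \<noteq> u 1"
      "k (Core (e, True, 0)) \<noteq> u 2"
    by simp_all
  then have "w 0 < 3" "w 1 < 3" "w 2 < 3" "u 0 < 3" "u 1 < 3" "u 2 < 3" "k (Core (e, True, 0)) < 3"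
    by auto
  \<comment> \<open>The triangle uses all three colours, and each outer vertex avoids two of them,
    so it takes that of its non-neighbour. No colour is left for the vertex of leg \<open>e\<close>,
    which is adjacent to all three outer vertices.\<close>
  moreover from this have "u 0 = w 0" "u 1 = w 1" "u 2 = w 2"
    using third_colour[of "w 0" "w 1" "w 2" "u 0"] third_colour[of "w 1" "w 0" "w 2" "u 1"]
      third_colour[of "w 2" "w 0" "w 1" "u 2"] neq by metis+
  ultimately show False
    using third_colour[of "w 0" "w 1" "w 2" "k (Core (e, True, 0))"] neq by metis
qed

subsection \<open>A tree-decomposition with 3-colourable bags\<close>

datatype node = Hub | Leg nat | Shift core core nat

text \<open>The hub has the three legs as children, and each linked pair hangs a path
  \<open>Shift a b 0\<close>, \<open>Shift a b 1\<close>, ... from its leg. The value at the root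
  \<open>Hub\<close> is a dummy.\<close>

fun par :: "node \<Rightarrow> node" where
  "par Hub = Hub"
| "par (Leg i) = Hub"
| "par (Shift a b 0) = Leg (fst a)"
| "par (Shift a b (Suc t)) = Shift a b t"

fun rank :: "node \<Rightarrow> nat" where
  "rank Hub = 0"
| "rank (Leg i) = 1"
| "rank (Shift a b t) = t + 2"

definition Nodes :: "node set" where
  "Nodes = insert Hub (Leg ` {..<3} \<union> {Shift a b t |a b t. linked a b \<and> t < 9})"

text \<open>The \<open>Shift\<close> path sweeps over the points of the shift graph, treating the
  pair \<open>(p, q)\<close> as the interval from \<open>p\<close> to \<open>q\<close>. Both core
  vertices stay throughout, so that they connect up to the leg.\<close>

fun bag :: "node \<Rightarrow> vertex set" where
  "bag Hub = {Core (i, True, j) |i j. i < 3 \<and> j < 3}"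
| "bag (Leg i) = {Core (i, s, j) |s j. j < 3}"
| "bag (Shift a b t) = {Core a, Core b} \<union> {Link a b p q |p q. p < q \<and> q < 9 \<and> p \<le> t \<and> t \<le> q}"

lemma in_Nodes [simp]:
  "Hub \<in> Nodes" "Leg i \<in> Nodes \<longleftrightarrow> i < 3" "Shift a b t \<in> Nodes \<longleftrightarrow> linked a b \<and> t < 9"
  unfolding Nodes_def by (blast, blast, blast)

lemma ranked_parents_Nodes: "ranked_parents Nodes Hub par rank"
proof
  have "Nodes \<subseteq> insert Hub (Leg ` {..<3} \<union>
      (\<Union>a\<in>Core_verts. \<Union>b\<in>Core_verts. \<Union>t<9. {Shift a b t}))"
    unfolding Nodes_def linked_def by blast
  then show "finite Nodes"
    by (rule finite_subset) (simp add: finite_Core_verts)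
  show "par i \<in> Nodes \<and> rank (par i) < rank i" if "i \<in> Nodes" "i \<noteq> Hub" for i
    using that by (cases i rule: par.cases) (auto simp: linked_def)
qed simp

lemma Verts_eq_Union_bag: "Verts = (\<Union>i\<in>Nodes. bag i)"
proof
  show "Verts \<subseteq> (\<Union>i\<in>Nodes. bag i)"
  proof
    fix v assume v: "v \<in> Verts"
    show "v \<in> (\<Union>i\<in>Nodes. bag i)"
    proof (cases v)
      case (Core a)
      then show ?thesis using v by (cases a) (auto intro!: bexI[of _ "Leg (fst a)"])
    next
      case (Link a b p q)
      then show ?thesis using v by (auto intro!: bexI[of _ "Shift a b p"])
    qed
  qed
  show "(\<Union>i\<in>Nodes. bag i) \<subseteq> Verts"
    by (auto simp: Nodes_def linked_def)
qed

lemma bag_edge: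
  assumes "u \<in> Verts" "v \<in> Verts" "adj u v"
  shows "\<exists>i\<in>Nodes. u \<in> bag i \<and> v \<in> bag i"
  using assms
proof (induction u v rule: adj.induct)
  case (1 a b)
  obtain i s j i' s' j' where ab: "a = (i, s, j)" "b = (i', s', j')" by (cases a; cases b)
  show ?case
  proof (cases "i = i'")
    case True
    then show ?thesis using 1 ab by (intro bexI[of _ "Leg i"]) auto
  next
    case False
    then show ?thesis using 1 ab by (intro bexI[of _ Hub]) auto
  qed
next
  case (2 c a b p q)
  then show ?case by (intro bexI[of _ "Shift a b p"]) auto
next
  case (3 a b p q c)
  then show ?case by (intro bexI[of _ "Shift a b p"]) auto
next
  case (4 a b p q a' b' p' q')
  \<comment> \<open>Adjacent pairs share the point at which one ends and the other begins; the sweep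
    at that point has both.\<close>
  then show ?case by (intro bexI[of _ "Shift a b (if q = p' then q else p)"]) auto
qed

text \<open>The topmost node is \<open>Hub\<close> for outer vertices, the leg for triangle
  vertices, and \<open>Shift a b p\<close>, where the interval opens, for a link vertex.\<close>

lemma bag_top:
  assumes "v \<in> Verts"
  shows "\<exists>i0\<in>Nodes. v \<in> bag i0 \<and>
    (\<forall>i\<in>Nodes. v \<in> bag i \<longrightarrow> i \<noteq> i0 \<longrightarrow> i \<noteq> Hub \<and> v \<in> bag (par i))"
proof (cases v)
  case (Core a)
  obtain i s j where a: "a = (i, s, j)" "i < 3" "j < 3" using assms Core by (cases a) auto
  have leg: "v \<in> bag (par n)" if n: "n \<in> Nodes" "v \<in> bag n" "n \<noteq> Hub" "n \<noteq> Leg i" for n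
    using n Core a by (cases n rule: par.cases) (auto simp: linked_def)
  show ?thesis
  proof (cases s)
    case True
    then show ?thesis using leg a Core by (intro bexI[of _ Hub]) (auto, force)
  next
    case False
    then have "n \<noteq> Hub" if "v \<in> bag n" for n using that a Core by auto
    then show ?thesis using False leg a Core by (intro bexI[of _ "Leg i"]) auto
  qed
next
  case (Link a b p q)
  have "n \<noteq> Hub \<and> v \<in> bag (par n)" if "n \<in> Nodes" "v \<in> bag n" "n \<noteq> Shift a b p" for n
    using that Link by (cases n rule: par.cases) auto
  then show ?thesis using assms Link by (intro bexI[of _ "Shift a b p"]) auto
qed

text \<open>The hub is coloured by leg and a leg by index. In a \<open>Shift\<close> bag, adjacent
  pairs can only meet at the sweep point \<open>t\<close>, so exactly one of them ends at
  \<open>t\<close>; this separates colours 1 and 2, and the non-adjacent \<open>a\<close> and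
  \<open>b\<close> take colour 0.\<close>

lemma bag_colorable:
  assumes "n \<in> Nodes" shows "colorable_on 3 adj (bag n)"
proof (cases n)
  case Hub
  then show ?thesis
    by (auto simp: colorable_on_def intro!: exI[of _ "\<lambda>v. case v of Core a \<Rightarrow> fst a | _ \<Rightarrow> 0"])
next
  case (Leg i)
  then show ?thesis
    by (auto simp: colorable_on_def intro!: exI[of _ "\<lambda>v. case v of Core a \<Rightarrow> snd (snd a) | _ \<Rightarrow> 0"])
next
  case (Shift a b t)
  then have "\<not> core_adj a b" using assms by (simp add: linked_def)
  moreover from this have "\<not> core_adj b a" using core_adj_sym by blast
  ultimately show ?thesis
    using Shift by (auto simp: colorable_on_def core_adj_irrefl
        intro!: exI[of _ "\<lambda>v. case v of Core a \<Rightarrow> 0 | Link a b p q \<Rightarrow> if q = t then 1 else 2"] split: if_splits)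
qed

section \<open>The infinite family of blow-ups, realised on natural numbers\<close>

theorem corollary1p4:
  fixes k :: nat
  assumes "k \<ge> 1"
  shows "\<exists>F :: nat pair_pre_digraph set.
    infinite F \<and>
    (\<forall>G\<in>F. \<forall>H\<in>F. G \<noteq> H \<longrightarrow> \<not> digraph_iso (with_proj G) (with_proj H)) \<and>
    (\<forall>G\<in>F. pair_graph G \<and> k_connected k (with_proj G) \<and>
       tree_chromatic_number (with_proj G) \<noteq> path_chromatic_number (with_proj G))"
proof -
  define N where "N = card Verts"
  have "{Core (0, True, 0), Core (0, False, 0)} \<subseteq> Verts" by simp
  then have "card {Core (0, True, 0), Core (0, False, 0)} \<le> N"
    unfolding N_def using finite_Verts by (intro card_mono)
  then have N: "2 \<le> N" by simp
  \<comment> \<open>Numbering \<open>Verts \<times> {..<m}\<close> by the first \<open>N * m\<close>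
    naturals gives a projection whose fibres all have size \<open>m\<close>.\<close>
  have "\<exists>\<pi>. blow_up Verts adj {..<N * m} \<pi> \<and> (\<forall>v\<in>Verts. card {x \<in> {..<N * m}. \<pi> x = v} = m)"
    if "1 \<le> m" for m
  proof -
    have "card (Verts \<times> {..<m}) = card {..<N * m}" by (simp add: N_def card_cartesian_product)
    then obtain f where f: "bij_betw f {..<N * m} (Verts \<times> {..<m})"
      using finite_Verts by (metis finite_SigmaI finite_lessThan finite_same_card_bij)
    have "card {x \<in> {..<N * m}. fst (f x) = v} = m" if "v \<in> Verts" for v
    proof -
      have "bij_betw f {x \<in> {..<N * m}. fst (f x) = v} ({v} \<times> {..<m})"
        unfolding bij_betw_def
      proof
        show "inj_on f {x \<in> {..<N * m}. fst (f x) = v}"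
          using f by (auto simp: bij_betw_def intro: inj_on_subset)
        have "f ` {x \<in> {..<N * m}. fst (f x) = v} = {y \<in> f ` {..<N * m}. fst y = v}" by auto
        also have "\<dots> = {v} \<times> {..<m}" using f that by (auto simp: bij_betw_def)
        finally show "f ` {x \<in> {..<N * m}. fst (f x) = v} = {v} \<times> {..<m}" .
      qed
      then show ?thesis by (simp add: bij_betw_same_card card_cartesian_product)
    qed
    moreover have "blow_up Verts adj {..<N * m} (fst \<circ> f)"
    proof
      have "{..<m} \<noteq> {}" using that by (auto simp: lessThan_empty_iff)
      moreover have "f ` {..<N * m} = Verts \<times> {..<m}" using f by (simp add: bij_betw_def)
      ultimately show "(fst \<circ> f) ` {..<N * m} = Verts" by (simp only: image_comp[symmetric] fst_image_times if_False)
    qed (use adj_sym adj_irrefl in auto)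
    ultimately show ?thesis by (intro exI[of _ "fst \<circ> f"]) simp
  qed
  then obtain \<pi> where \<pi>: "\<And>m. 1 \<le> m \<Longrightarrow> blow_up Verts adj {..<N * m} (\<pi> m)"
    "\<And>m v. 1 \<le> m \<Longrightarrow> v \<in> Verts \<Longrightarrow> card {x \<in> {..<N * m}. \<pi> m x = v} = m"
    by metis
  define G where "G m = pullback (\<pi> m) adj {..<N * m}" for m
  have card_G: "card (pverts (G m)) = N * m" for m by (simp add: G_def)
  \<comment> \<open>Starting at \<open>k\<close> makes the fibres large enough for
    \<open>k\<close>-connectedness. The order \<open>N * m\<close> tells the graphs apart, and below
    it also excludes isomorphisms.\<close>
  have "infinite (G ` {k..})"
  proof
    have "inj_on G {k..}" using card_G N by (metis (no_types) inj_onI mult_cancel1 not_numeral_le_zero)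
    moreover assume "finite (G ` {k..})"
    ultimately show False using finite_imageD infinite_Ici by blast
  qed
  moreover have "\<not> digraph_iso (with_proj (G m)) (with_proj (G l))" if "G m \<noteq> G l" for m l
  proof
    assume "digraph_iso (with_proj (G m)) (with_proj (G l))"
    then obtain f where f: "pre_digraph.digraph_isomorphism (with_proj (G m)) f"
      "with_proj (G l) = app_iso f (with_proj (G m))"
      unfolding digraph_iso_def by blast
    then have "inj_on (iso_verts f) (verts (with_proj (G m)))"
      by (simp add: pre_digraph.digraph_isomorphism_def)
    with f(2) have "card (verts (with_proj (G l))) = card (verts (with_proj (G m)))"
      by (simp only: verts_app_iso card_image)
    then have "card (pverts (G m)) = card (pverts (G l))" by simp
    then show False using that card_G N by simp
  qed
  moreover have "pair_graph (G m) \<and> k_connected k (with_proj (G m)) \<and>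
      tree_chromatic_number (with_proj (G m)) \<noteq> path_chromatic_number (with_proj (G m))"
    if "k \<le> m" for m
  proof -
    have m: "1 \<le> m" using that assms by simp
    interpret blow_up Verts adj "{..<N * m}" "\<pi> m" using \<pi>(1)[OF m] .
    \<comment> \<open>Two base vertices and \<open>m \<ge> 1\<close> turn \<open>k \<le> m\<close>
      into the strict bound on the order that \<open>k_connected\<close> demands.\<close>
    have "2 * m \<le> N * m" using N by simp
    then have "k < N * m" using m that by linarith
    then have "k_connected k (with_proj (G m))"
      unfolding G_def using \<pi>(2)[OF m] that adj_connected
      by (intro k_connected_pullback) simp_all
    moreover have "tree_chromatic_number (with_proj (G m)) \<le> 3"
      unfolding G_def
      by (rule tree_chromatic_number_pullback_le[OF ranked_parents_Nodes Verts_eq_Union_bag])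
        (use bag_edge bag_top bag_colorable in blast)+
    moreover have "3 < path_chromatic_number (with_proj (G m))"
      unfolding G_def by (rule path_chromatic_number_pullback_greater) (use no_path_bags in blast)
    ultimately show ?thesis using pair_graph_pullback by (simp add: G_def)
  qed
  ultimately show ?thesis by (intro exI[of _ "G ` {k..}"]) auto
qed

end
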